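(* Let $G=G(I,P;E)$ be an Assur graph such that $G$ and the graph $G^*$ obtained by identifying all pinned vertices to one vertex are planar. Then there is a configuration $\mathbf p$ of $I\cup P$ in $\mathbb R^2$ (with distinct positions for the pinned vertices) such that: (1) the pinned framework $G(\mathbf p)$ has a one-dimensional space of self-stresses, spanned by a self-stress which is non-zero on every edge; and (2) $G(\mathbf p)$ has, up to scalar multiples, a unique non-trivial first-order motion (with the pinned vertices fixed), and this motion assigns a non-zero velocity to every inner vertex.
   Context: A pinned graph $G(I,P;E)$ has a set $I$ of inner vertices, a set $P$ of pinned vertices, and edge set $E$ in which every edge has at least one endpoint in $I$. A pinned framework $G(\mathbf p)$ places all vertices at points of $\mathbb R^2$, pinned vertices regarded as fixed. A first-order motion assigns $\mathbf p'_i\in\mathbb R^2$ to inner vertices ($\mathbf p'_v=\mathbf 0$ for $v\in P$) with $(\mathbf p_i-\mathbf p_j)\cdot(\mathbf p'_i-\mathbf p'_j)=0$ for all edges $ij$. A self-stress is an assignment of scalars $\lambda_{ij}$ to edges with $\sum_{j:ij\in E}\lambda_{ij}(\mathbf p_i-\mathbf p_j)=\mathbf 0$ at every inner vertex $i$ (a row dependency of the $|E|\times 2|I|$ pinned rigidity matrix). Pinned Framework Conditions: $|E|=2|I|$ and for every subgraph $G'(I',P';E')$ with $E'\ne\emptyset$: $|E'|\le 2|I'|$ if $|P'|\ge2$, $|E'|\le 2|I'|-1$ if $|P'|=1$, $|E'|\le 2|I'|-3$ if $P'=\emptyset$; graphs satisfying these are called pinned isostatic. A rigidity circuit is a (multi)graph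 with edge set $C$, $|C|=2|V(C)|-2$, and every nonempty proper subset $F$ satisfies $|F|\le 2|V(F)|-3$. An Assur graph is a pinned isostatic graph such that identifying all pinned vertices to a single vertex (keeping all edges) yields a rigidity circuit. *)

theory Defs
  imports "HOL-Analysis.Analysis"
begin

text \<open>A (multi)graph is given by a finite edge set E together with two endpoint
  maps s t.  A pinned graph G(I,P;E): inner vertices I, pinned vertices P.\<close>

definition pinned_graph :: "'v set \<Rightarrow> 'v set \<Rightarrow> 'e set \<Rightarrow> ('e \<Rightarrow> 'v) \<Rightarrow> ('e \<Rightarrow> 'v) \<Rightarrow> bool" where
  "pinned_graph I P E s t \<longleftrightarrow> finite I \<and> finite P \<and> finite E \<and> I \<inter> P = {} \<and>
     (\<forall>e\<in>E. s e \<in> I \<union> P \<and> t e \<in> I \<union> P \<and> s e \<noteq> t e \<and> (s e \<in> I \<or> t e \<in> I))"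

definition pinned_isostatic :: "'v set \<Rightarrow> 'v set \<Rightarrow> 'e set \<Rightarrow> ('e \<Rightarrow> 'v) \<Rightarrow> ('e \<Rightarrow> 'v) \<Rightarrow> bool" where
  "pinned_isostatic I P E s t \<longleftrightarrow> pinned_graph I P E s t \<and>
     int (card E) = 2 * int (card I) \<and>
     (\<forall>I' P' E'. I' \<subseteq> I \<longrightarrow> P' \<subseteq> P \<longrightarrow> E' \<subseteq> E \<longrightarrow> E' \<noteq> {} \<longrightarrow>
        (\<forall>e\<in>E'. s e \<in> I' \<union> P' \<and> t e \<in> I' \<union> P') \<longrightarrow>
        (if card P' \<ge> 2 then int (card E') \<le> 2 * int (card I')
         else if card P' = 1 then int (card E') \<le> 2 * int (card I') - 1
         else int (card E') \<le> 2 * int (card I') - 3))"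

definition edge_verts :: "'e set \<Rightarrow> ('e \<Rightarrow> 'w) \<Rightarrow> ('e \<Rightarrow> 'w) \<Rightarrow> 'w set" where
  "edge_verts F a b = a ` F \<union> b ` F"

definition rigidity_circuit :: "'e set \<Rightarrow> ('e \<Rightarrow> 'w) \<Rightarrow> ('e \<Rightarrow> 'w) \<Rightarrow> bool" where
  "rigidity_circuit C a b \<longleftrightarrow> finite C \<and>
     int (card C) = 2 * int (card (edge_verts C a b)) - 2 \<and>
     (\<forall>F. F \<subset> C \<longrightarrow> F \<noteq> {} \<longrightarrow> int (card F) \<le> 2 * int (card (edge_verts F a b)) - 3)"

definition ident_pins :: "'v set \<Rightarrow> 'v \<Rightarrow> 'v option" where
  "ident_pins P v = (if v \<in> P then None else Some v)"

definition assur_graph :: "'v set \<Rightarrow> 'v set \<Rightarrow> 'e set \<Rightarrow> ('e \<Rightarrow> 'v) \<Rightarrow> ('e \<Rightarrow> 'v) \<Rightarrow> bool" where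
  "assur_graph I P E s t \<longleftrightarrow> pinned_isostatic I P E s t \<and>
     rigidity_circuit E (ident_pins P \<circ> s) (ident_pins P \<circ> t)"

definition planar :: "'w set \<Rightarrow> 'e set \<Rightarrow> ('e \<Rightarrow> 'w) \<Rightarrow> ('e \<Rightarrow> 'w) \<Rightarrow> bool" where
  "planar V E a b \<longleftrightarrow> (\<exists>(pos :: 'w \<Rightarrow> real^2) (\<gamma> :: 'e \<Rightarrow> real \<Rightarrow> real^2).
     inj_on pos V \<and>
     (\<forall>e\<in>E. arc (\<gamma> e) \<and> pathstart (\<gamma> e) = pos (a e) \<and> pathfinish (\<gamma> e) = pos (b e)) \<and>
     (\<forall>e\<in>E. \<forall>v\<in>V. v \<noteq> a e \<longrightarrow> v \<noteq> b e \<longrightarrow> pos v \<notin> path_image (\<gamma> e)) \<and>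
     (\<forall>e\<in>E. \<forall>e'\<in>E. e \<noteq> e' \<longrightarrow>
        path_image (\<gamma> e) \<inter> path_image (\<gamma> e') \<subseteq>
          {pos (a e), pos (b e)} \<inter> {pos (a e'), pos (b e')}))"

definition first_order_motion :: "'v set \<Rightarrow> 'e set \<Rightarrow> ('e \<Rightarrow> 'v) \<Rightarrow> ('e \<Rightarrow> 'v) \<Rightarrow>
    ('v \<Rightarrow> real^2) \<Rightarrow> ('v \<Rightarrow> real^2) \<Rightarrow> bool" where
  "first_order_motion I E s t p p' \<longleftrightarrow> (\<forall>v. v \<notin> I \<longrightarrow> p' v = 0) \<and>
     (\<forall>e\<in>E. (p (s e) - p (t e)) \<bullet> (p' (s e) - p' (t e)) = 0)"

definition self_stress :: "'v set \<Rightarrow> 'e set \<Rightarrow> ('e \<Rightarrow> 'v) \<Rightarrow> ('e \<Rightarrow> 'v) \<Rightarrow>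
    ('v \<Rightarrow> real^2) \<Rightarrow> ('e \<Rightarrow> real) \<Rightarrow> bool" where
  "self_stress I E s t p \<omega> \<longleftrightarrow> (\<forall>e. e \<notin> E \<longrightarrow> \<omega> e = 0) \<and>
     (\<forall>i\<in>I. (\<Sum>e\<in>{e\<in>E. s e = i}. \<omega> e *\<^sub>R (p i - p (t e))) +
            (\<Sum>e\<in>{e\<in>E. t e = i}. \<omega> e *\<^sub>R (p i - p (s e))) = 0)"

end

theory Submission
  imports Defs "HOL-Computational_Algebra.Polynomial"
begin

text \<open>Place the vertices of the circuit G* generically, with the identified pin at the origin.
  By Laman's theorem the pinned rigidity matrix then has corank one, its row dependency is nowhere
  zero, and its kernel is spanned by the rotation about the origin, which moves every inner vertex.
  All of this depends only on the directions of the edges. So it suffices to find another placement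
  of G with the same edge directions, up to a common quarter turn, and with distinct pins. The pin
  positions that extend to such a placement form a subspace of codimension at most one, which
  contains tuples of distinct points.

  Laman's theorem is obtained by Lovasz's hyperplane argument: generic directions, chosen
  independently for the edges of a Laman-sparse graph, give independent rows even after one edge is
  doubled, and a vector orthogonal to these rows and to no whole edge is, up to a quarter turn, a
  placement realising the directions.\<close>

section \<open>Independent rows\<close>

text \<open>Independence as an indexed family, so parallel edges with equal rows count as dependent.
  The column set \<open>K\<close> is explicit so that columns can be deleted.\<close>

definition rows_indep :: "'e set \<Rightarrow> 'k set \<Rightarrow> ('e \<Rightarrow> 'k \<Rightarrow> real) \<Rightarrow> bool" where
  "rows_indep S K u \<longleftrightarrow>
     (\<forall>c. (\<forall>k\<in>K. (\<Sum>e\<in>S. c e * u e k) = 0) \<longrightarrow> (\<forall>e\<in>S. c e = 0))"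

lemma rows_indepI:
  assumes "\<And>c e. (\<And>k. k \<in> K \<Longrightarrow> (\<Sum>e\<in>S. c e * u e k) = 0) \<Longrightarrow> e \<in> S \<Longrightarrow> c e = 0"
  shows "rows_indep S K u"
  using assms unfolding rows_indep_def by blast

lemma rows_indepD:
  assumes "rows_indep S K u" "\<And>k. k \<in> K \<Longrightarrow> (\<Sum>e\<in>S. c e * u e k) = 0" "e \<in> S"
  shows "c e = 0"
  using assms unfolding rows_indep_def by blast

lemma rows_indep_cong:
  assumes "\<And>e k. e \<in> S \<Longrightarrow> k \<in> K \<Longrightarrow> u e k = u' e k"
  shows "rows_indep S K u \<longleftrightarrow> rows_indep S K u'"
  unfolding rows_indep_def using assms by simp

lemma rows_indep_subset:
  assumes "rows_indep S K u" "T \<subseteq> S" "finite S"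
  shows "rows_indep T K u"
proof (rule rows_indepI)
  fix c e assume c: "\<And>k. k \<in> K \<Longrightarrow> (\<Sum>e\<in>T. c e * u e k) = 0" and e: "e \<in> T"
  have "(\<Sum>e\<in>S. (if e \<in> T then c e else 0) * u e k) = (\<Sum>e\<in>T. c e * u e k)" for k
    by (rule sum.mono_neutral_cong_right) (use assms in auto)
  then have "(if e \<in> T then c e else 0) = 0"
    using rows_indepD[OF assms(1), of "\<lambda>e. if e \<in> T then c e else 0" e] c e assms(2) by auto
  then show "c e = 0" using e by simp
qed

lemma rows_indep_nonzero:
  assumes "rows_indep S K u" "finite S" "e \<in> S"
  obtains k where "k \<in> K" "u e k \<noteq> 0"
proof -
  have "\<exists>k\<in>K. u e k \<noteq> 0"
  proof (rule ccontr)
    assume *: "\<not> (\<exists>k\<in>K. u e k \<noteq> 0)"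
    have "(\<Sum>f\<in>S. of_bool (f = e) * u f k) = 0" if "k \<in> K" for k
      by (rule sum.neutral) (use * that in auto)
    then have "of_bool (e = e) = (0::real)"
      using rows_indepD[OF assms(1), of "\<lambda>f. of_bool (f = e)" e] assms(3) by blast
    then show False by simp
  qed
  then show ?thesis using that by blast
qed

text \<open>An independent family has no zero row, so no \<open>g e\<close> vanishes and
  coefficients can be divided by it.\<close>

lemma rows_indep_scaleD:
  assumes "rows_indep S K (\<lambda>e k. g e * u e k)" "finite S"
  shows "rows_indep S K u"
proof (rule rows_indepI)
  fix c e assume c: "\<And>k. k \<in> K \<Longrightarrow> (\<Sum>e\<in>S. c e * u e k) = 0" and e: "e \<in> S"
  have g: "g f \<noteq> 0" if "f \<in> S" for f
    using rows_indep_nonzero[OF assms that] by (metis mult_zero_left)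
  have "(\<Sum>f\<in>S. (c f / g f) * (g f * u f k)) = (\<Sum>f\<in>S. c f * u f k)" for k
    by (rule sum.cong) (use g in auto)
  then have "c e / g e = 0"
    using rows_indepD[OF assms(1), of "\<lambda>e. c e / g e" e] c e by simp
  then show "c e = 0" using g[OF e] by simp
qed

text \<open>One elimination step, clearing column \<open>k0\<close> by cross-multiplication.
  Avoiding division keeps polynomial entries polynomial.\<close>

lemma rows_indep_pivot:
  assumes "finite S" "e \<notin> S" "k0 \<in> K" "u e k0 \<noteq> 0"
  shows "rows_indep (insert e S) K u \<longleftrightarrow>
         rows_indep S K (\<lambda>f k. u e k0 * u f k - u f k0 * u e k)" (is "?L \<longleftrightarrow> rows_indep S K ?v")
proof
  assume L: ?L
  show "rows_indep S K ?v"
  proof (rule rows_indepI)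
    fix c f assume c: "\<And>k. k \<in> K \<Longrightarrow> (\<Sum>f\<in>S. c f * ?v f k) = 0" and f: "f \<in> S"
    define d where "d = (\<lambda>f. if f = e then - (\<Sum>f\<in>S. c f * u f k0) else c f * u e k0)"
    have "(\<Sum>f\<in>insert e S. d f * u f k) = 0" if "k \<in> K" for k
    proof -
      have "(\<Sum>f\<in>insert e S. d f * u f k)
          = - (\<Sum>f\<in>S. c f * u f k0) * u e k + (\<Sum>f\<in>S. d f * u f k)"
        using assms by (simp add: d_def)
      also have "(\<Sum>f\<in>S. d f * u f k) = (\<Sum>f\<in>S. c f * u e k0 * u f k)"
        by (rule sum.cong) (use assms in \<open>auto simp: d_def\<close>)
      also have "- (\<Sum>f\<in>S. c f * u f k0) * u e k + \<dots> = (\<Sum>f\<in>S. c f * ?v f k)"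
        by (simp add: sum_distrib_left sum_subtractf algebra_simps)
      finally show ?thesis using c[OF that] by simp
    qed
    then have "d f = 0" using rows_indepD[OF L, of d f] f by simp
    then show "c f = 0" using f assms by (auto simp: d_def split: if_splits)
  qed
next
  assume R: "rows_indep S K ?v"
  show ?L
  proof (rule rows_indepI)
    fix c f assume c: "\<And>k. k \<in> K \<Longrightarrow> (\<Sum>f\<in>insert e S. c f * u f k) = 0" and f: "f \<in> insert e S"
    have c': "(\<Sum>f\<in>S. c f * u f k) = - c e * u e k" if "k \<in> K" for k
      using c[OF that] assms by simp
    have "(\<Sum>f\<in>S. c f * ?v f k) = 0" if "k \<in> K" for k
    proof -
      have "(\<Sum>f\<in>S. c f * ?v f k)
          = u e k0 * (\<Sum>f\<in>S. c f * u f k) - (\<Sum>f\<in>S. c f * u f k0) * u e k"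
        by (simp add: sum_distrib_right sum_distrib_left sum_subtractf algebra_simps)
      then show ?thesis using c'[OF that] c'[OF assms(3)] by simp
    qed
    then have S0: "c g = 0" if "g \<in> S" for g using rows_indepD[OF R, of c g] that by simp
    then have "c e * u e k0 = 0" using c'[OF assms(3)] by simp
    then show "c f = 0" using f S0 assms by auto
  qed
qed

text \<open>Induction by elimination: the row of \<open>e\<close> clears column \<open>k0\<close>,
  which can then be deleted along with that row.\<close>

lemma rows_indep_card_le:
  assumes "finite S" "finite K" "rows_indep S K u"
  shows "card S \<le> card K"
  using assms
proof (induction S arbitrary: K u rule: finite_induct)
  case (insert e S)
  obtain k0 where k0: "k0 \<in> K" "u e k0 \<noteq> 0"
    using rows_indep_nonzero[OF insert.prems(2)] insert.hyps by blast
  let ?v = "\<lambda>f k. u e k0 * u f k - u f k0 * u e k"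
  have "rows_indep S K ?v"
    using rows_indep_pivot[of S e k0 K u] insert k0 by blast
  moreover have "(\<Sum>f\<in>S. c f * ?v f k0) = 0" for c by simp
  ultimately have "rows_indep S (K - {k0}) ?v"
    unfolding rows_indep_def by blast
  then have "card S \<le> card (K - {k0})"
    using insert.IH insert.prems(1) by blast
  moreover have "card K > 0" using k0 insert.prems(1) card_gt_0_iff by blast
  ultimately show ?case using k0 insert.hyps insert.prems(1) by simp
qed simp

text \<open>Induction by elimination: solve the cleared system first, with right-hand sides
  eliminated alike, then correct coordinate \<open>k0\<close>.\<close>

lemma rows_indep_surj:
  assumes "finite S" "finite K" "rows_indep S K u"
  shows "\<exists>x. \<forall>e\<in>S. (\<Sum>k\<in>K. u e k * x k) = b e"
  using assms(1,3)
proof (induction S arbitrary: u b rule: finite_induct)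
  case (insert e S)
  obtain k0 where k0: "k0 \<in> K" "u e k0 \<noteq> 0"
    using rows_indep_nonzero[OF insert.prems(1)] insert.hyps by blast
  let ?v = "\<lambda>f k. u e k0 * u f k - u f k0 * u e k"
  have "rows_indep S K ?v"
    using rows_indep_pivot[of S e k0 K u] insert k0 by blast
  from insert.IH[OF this, of "\<lambda>f. u e k0 * b f - u f k0 * b e"] obtain x where
    x: "\<And>f. f \<in> S \<Longrightarrow> (\<Sum>k\<in>K. ?v f k * x k) = u e k0 * b f - u f k0 * b e" by blast
  \<comment> \<open>The cleared rows vanish in column \<open>k0\<close>, so this coordinate is free
    to satisfy the equation of \<open>e\<close>.\<close>
  define y where "y = x(k0 := x k0 + (b e - (\<Sum>k\<in>K. u e k * x k)) / u e k0)"
  have split: "(\<Sum>k\<in>K. g k * y k) = (\<Sum>k\<in>K. g k * x k) + g k0 * (y k0 - x k0)" for g :: "'b \<Rightarrow> real"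
  proof -
    have "(\<Sum>k\<in>K. g k * y k) = g k0 * y k0 + (\<Sum>k\<in>K - {k0}. g k * y k)"
      using k0 assms(2) by (intro sum.remove)
    also have "(\<Sum>k\<in>K - {k0}. g k * y k) = (\<Sum>k\<in>K - {k0}. g k * x k)"
      by (rule sum.cong) (auto simp: y_def)
    finally show ?thesis
      using k0 assms(2) by (simp add: sum.remove[of K k0 "\<lambda>k. g k * x k"] algebra_simps)
  qed
  have ye: "(\<Sum>k\<in>K. u e k * y k) = b e"
    using split[of "u e"] k0 by (simp add: y_def)
  have "(\<Sum>k\<in>K. u f k * y k) = b f" if "f \<in> S" for f
  proof -
    have "u e k0 * (\<Sum>k\<in>K. u f k * y k) - u f k0 * (\<Sum>k\<in>K. u e k * y k) = (\<Sum>k\<in>K. ?v f k * y k)"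
      by (simp add: sum_distrib_left sum_subtractf algebra_simps)
    also have "\<dots> = u e k0 * b f - u f k0 * b e"
      using split[of "?v f"] x[OF that] by simp
    finally show ?thesis using ye k0 by simp
  qed
  then show ?case using ye by blast
qed simp

text \<open>A kernel vector that is nonzero at \<open>k0\<close> makes that column a combination of
  the others, so deleting it loses nothing.\<close>

lemma rows_indep_drop_col:
  assumes "rows_indep S K u" "finite K" "k0 \<in> K" "x k0 \<noteq> 0"
    and ker: "\<And>e. e \<in> S \<Longrightarrow> (\<Sum>k\<in>K. u e k * x k) = 0"
  shows "rows_indep S (K - {k0}) u"
proof (rule rows_indepI)
  fix c e assume c: "\<And>k. k \<in> K - {k0} \<Longrightarrow> (\<Sum>e\<in>S. c e * u e k) = 0" and e: "e \<in> S"
  let ?w = "\<lambda>k. \<Sum>e\<in>S. c e * u e k"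
  have "(\<Sum>k\<in>K. ?w k * x k) = (\<Sum>k\<in>K. \<Sum>e\<in>S. c e * (u e k * x k))"
    by (simp add: sum_distrib_right mult.assoc)
  also have "\<dots> = (\<Sum>e\<in>S. c e * (\<Sum>k\<in>K. u e k * x k))"
    by (subst sum.swap) (simp add: sum_distrib_left)
  also have "\<dots> = 0" using ker by simp
  finally have "(\<Sum>k\<in>K. ?w k * x k) = 0" .
  moreover have "(\<Sum>k\<in>K. ?w k * x k) = ?w k0 * x k0"
    using assms(2,3) c by (simp add: sum.remove[of K k0])
  ultimately have "?w k0 = 0" using assms(4) by simp
  then have "?w k = 0" if "k \<in> K" for k using c that by blast
  then show "c e = 0" using rows_indepD[OF assms(1), of c e] e by blast
qed

text \<open>A nonzero coordinate would let its column be dropped, leaving fewer columns than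
  independent rows.\<close>

lemma rows_indep_kernel_trivial:
  assumes "rows_indep S K u" "finite S" "finite K" "card K \<le> card S"
    and "\<And>e. e \<in> S \<Longrightarrow> (\<Sum>k\<in>K. u e k * x k) = 0" and "k \<in> K"
  shows "x k = 0"
proof (rule ccontr)
  assume "x k \<noteq> 0"
  then have "rows_indep S (K - {k}) u"
    by (rule rows_indep_drop_col[OF assms(1,3,6) _ assms(5)])
  then have "card S \<le> card (K - {k})" using rows_indep_card_le assms(2,3) by blast
  moreover have "card (K - {k}) < card K" using assms by (intro card_Diff1_less) auto
  ultimately show False using assms(4) by simp
qed

text \<open>Subtract from \<open>y\<close> the multiple of \<open>x\<close> agreeing with it at
  \<open>k0\<close>; the rest lies in the kernel after deletion of that column, which is trivial by
  counting.\<close>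

lemma rows_indep_kernel_line:
  assumes "rows_indep S K u" "finite S" "finite K" "card K \<le> Suc (card S)"
    and x: "\<And>e. e \<in> S \<Longrightarrow> (\<Sum>k\<in>K. u e k * x k) = 0" and "k0 \<in> K" "x k0 \<noteq> 0"
    and y: "\<And>e. e \<in> S \<Longrightarrow> (\<Sum>k\<in>K. u e k * y k) = 0"
  shows "\<exists>c. \<forall>k\<in>K. y k = c * x k"
proof -
  define c where "c = y k0 / x k0"
  define z where "z = (\<lambda>k. y k - c * x k)"
  have z0: "z k0 = 0" using assms by (simp add: z_def c_def)
  have "(\<Sum>k\<in>K. u e k * z k) = 0" if "e \<in> S" for e
  proof -
    have "(\<Sum>k\<in>K. u e k * z k) = (\<Sum>k\<in>K. u e k * y k) - c * (\<Sum>k\<in>K. u e k * x k)"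
      by (simp add: z_def sum_distrib_left sum_subtractf algebra_simps)
    then show ?thesis using x y that by simp
  qed
  then have zk: "(\<Sum>k\<in>K - {k0}. u e k * z k) = 0" if "e \<in> S" for e
    using that z0 assms(3,6) by (simp add: sum.remove[of K k0])
  have "rows_indep S (K - {k0}) u"
    by (rule rows_indep_drop_col[OF assms(1,3,6,7) x])
  moreover have "card (K - {k0}) \<le> card S" using assms by simp
  ultimately have "z k = 0" if "k \<in> K - {k0}" for k
    using rows_indep_kernel_trivial[of S "K - {k0}" u z k] assms(2,3) zk that by simp
  then have "\<forall>k\<in>K. y k = c * x k" using z0 unfolding z_def by auto
  then show ?thesis by blast
qed

section \<open>Spans of rows\<close>

definition in_row_span :: "'e set \<Rightarrow> 'k set \<Rightarrow> ('e \<Rightarrow> 'k \<Rightarrow> real) \<Rightarrow> ('k \<Rightarrow> real) \<Rightarrow> bool" where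
  "in_row_span S K u w \<longleftrightarrow> (\<exists>M. \<forall>k\<in>K. w k = (\<Sum>e\<in>S. M e * u e k))"

lemma in_row_span_base:
  assumes "finite S" "e \<in> S"
  shows "in_row_span S K u (u e)"
  unfolding in_row_span_def
  by (rule exI[of _ "\<lambda>f. if f = e then 1 else 0"])
    (use assms in \<open>simp add: if_distrib[of "\<lambda>x. x * _"] cong: if_cong\<close>)

lemma in_row_span_lincomb:
  assumes "\<And>j. j \<in> J \<Longrightarrow> in_row_span S K u (w j)"
  shows "in_row_span S K u (\<lambda>k. \<Sum>j\<in>J. c j * w j k)"
proof -
  obtain M where M: "\<And>j k. j \<in> J \<Longrightarrow> k \<in> K \<Longrightarrow> w j k = (\<Sum>e\<in>S. M j e * u e k)"
    using assms unfolding in_row_span_def by metis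
  have "(\<Sum>j\<in>J. c j * w j k) = (\<Sum>e\<in>S. (\<Sum>j\<in>J. c j * M j e) * u e k)" if "k \<in> K" for k
  proof -
    have "(\<Sum>j\<in>J. c j * w j k) = (\<Sum>j\<in>J. \<Sum>e\<in>S. c j * M j e * u e k)"
      using M that by (simp add: sum_distrib_left mult.assoc)
    then show ?thesis by (subst (asm) sum.swap) (simp add: sum_distrib_right)
  qed
  then show ?thesis unfolding in_row_span_def
    by (intro exI[of _ "\<lambda>e. \<Sum>j\<in>J. c j * M j e"]) blast
qed

lemma in_row_span_add:
  assumes "in_row_span S K u v" "in_row_span S K u w"
  shows "in_row_span S K u (\<lambda>k. v k + w k)"
  using in_row_span_lincomb[of "UNIV :: bool set" S K u "\<lambda>j. if j then v else w" "\<lambda>_. 1"] assms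
  by (simp add: UNIV_bool add.commute)

lemma in_row_span_uminus:
  assumes "in_row_span S K u v"
  shows "in_row_span S K u (\<lambda>k. - v k)"
  using in_row_span_lincomb[of "{()}" S K u "\<lambda>_. v" "\<lambda>_. -1"] assms by simp

lemma in_row_span_cong:
  assumes "in_row_span S K u v" "\<And>k. k \<in> K \<Longrightarrow> v k = w k"
  shows "in_row_span S K u w"
  using assms unfolding in_row_span_def by metis

text \<open>Steinitz bound: a dependency among the rows of the coefficient matrix \<open>M\<close>
  would carry over to the vectors \<open>w j\<close>.\<close>

lemma rows_indep_in_span_card_le:
  assumes "finite S" "finite J" "rows_indep J K w" "\<And>j. j \<in> J \<Longrightarrow> in_row_span S K u (w j)"
  shows "card J \<le> card S"
proof -
  obtain M where M: "\<And>j k. j \<in> J \<Longrightarrow> k \<in> K \<Longrightarrow> w j k = (\<Sum>e\<in>S. M j e * u e k)"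
    using assms(4) unfolding in_row_span_def by metis
  have "rows_indep J S M"
  proof (rule rows_indepI)
    fix c j assume c: "\<And>e. e \<in> S \<Longrightarrow> (\<Sum>j\<in>J. c j * M j e) = 0" and j: "j \<in> J"
    have "(\<Sum>j\<in>J. c j * w j k) = 0" if "k \<in> K" for k
    proof -
      have "(\<Sum>j\<in>J. c j * w j k) = (\<Sum>j\<in>J. \<Sum>e\<in>S. c j * M j e * u e k)"
        using M that by (simp add: sum_distrib_left mult.assoc)
      also have "\<dots> = (\<Sum>e\<in>S. (\<Sum>j\<in>J. c j * M j e) * u e k)"
        by (subst sum.swap) (simp add: sum_distrib_right)
      finally show ?thesis using c by simp
    qed
    then show "c j = 0" using rows_indepD[OF assms(3), of c j] j by blast
  qed
  then show ?thesis using rows_indep_card_le assms(1,2) by blast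
qed

lemma dependent_row_in_span:
  assumes "finite S" "e \<notin> S" "rows_indep S K u" "\<not> rows_indep (insert e S) K u"
  shows "in_row_span S K u (u e)"
proof -
  obtain c f where c: "\<And>k. k \<in> K \<Longrightarrow> (\<Sum>f\<in>insert e S. c f * u f k) = 0"
    and f: "f \<in> insert e S" "c f \<noteq> 0"
    using assms(4) unfolding rows_indep_def by blast
  have c': "c e * u e k + (\<Sum>f\<in>S. c f * u f k) = 0" if "k \<in> K" for k
    using c[OF that] assms by simp
  have ce: "c e \<noteq> 0"
  proof
    assume "c e = 0"
    then have "\<forall>g\<in>S. c g = 0" using rows_indepD[OF assms(3), of c] c' by simp
    then show False using f \<open>c e = 0\<close> by auto
  qed
  have "u e k = (\<Sum>f\<in>S. (- c f / c e) * u f k)" if "k \<in> K" for k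
  proof -
    have "(\<Sum>f\<in>S. (- c f / c e) * u f k) = - (\<Sum>f\<in>S. c f * u f k) / c e"
      by (simp add: sum_divide_distrib sum_negf)
    also have "\<dots> = u e k" using c'[OF that] ce by (simp add: field_simps)
    finally show ?thesis by simp
  qed
  then show ?thesis unfolding in_row_span_def by (intro exI[of _ "\<lambda>f. - c f / c e"]) blast
qed

section \<open>Genericity\<close>

text \<open>Genericity tested along lines through good points; it stands in for Zariski openness and
  needs only polynomials in one variable.\<close>

definition generic_prop :: "(('a \<Rightarrow> 'b::real_vector) \<Rightarrow> bool) \<Rightarrow> bool" where
  "generic_prop Q \<longleftrightarrow>
     (\<forall>w w'. Q w \<longrightarrow> finite {\<tau>. \<not> Q (\<lambda>i. w i + \<tau> *\<^sub>R (w' i - w i))})"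

text \<open>Join a point good for the earlier properties to one good for the new property; each
  property fails at finitely many points of the line through them.\<close>

lemma generic_prop_common:
  assumes "finite J" "\<And>j. j \<in> J \<Longrightarrow> generic_prop (Q j)" "\<And>j. j \<in> J \<Longrightarrow> \<exists>w. Q j w"
  shows "\<exists>w. \<forall>j\<in>J. Q j w"
  using assms
proof (induction J rule: finite_induct)
  case (insert j J)
  then obtain w where w: "\<And>i. i \<in> J \<Longrightarrow> Q i w" by auto
  obtain w' where w': "Q j w'" using insert.prems by blast
  define L where "L = (\<lambda>\<tau> i. w i + \<tau> *\<^sub>R (w' i - w i))"
  have fin: "finite {\<tau>. \<not> Q i (L \<tau>)}" if "i \<in> J" for i
    using insert.prems(1)[of i] w[OF that] that unfolding generic_prop_def L_def by blast
  \<comment> \<open>Genericity of \<open>Q j\<close> is available from its own good point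
    \<open>w'\<close>, so the line is traversed backwards.\<close>
  have rev: "(\<lambda>i. w' i + (1 - \<tau>) *\<^sub>R (w i - w' i)) = L \<tau>" for \<tau>
    by (rule ext) (simp add: L_def algebra_simps)
  have "finite {\<tau>. \<not> Q j (\<lambda>i. w' i + \<tau> *\<^sub>R (w i - w' i))}" (is "finite ?B")
    using insert.prems(1)[of j] w' unfolding generic_prop_def by blast
  then have "finite ((\<lambda>\<tau>. 1 - \<tau>) ` ?B)" by simp
  moreover have "{\<tau>. \<not> Q j (L \<tau>)} \<subseteq> (\<lambda>\<tau>. 1 - \<tau>) ` ?B"
  proof
    fix \<tau> assume "\<tau> \<in> {\<tau>. \<not> Q j (L \<tau>)}"
    then have "1 - \<tau> \<in> ?B" using rev[of \<tau>] by simp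
    then show "\<tau> \<in> (\<lambda>\<tau>. 1 - \<tau>) ` ?B" by (intro image_eqI[of _ _ "1 - \<tau>"]) auto
  qed
  ultimately have "finite {\<tau>. \<not> Q j (L \<tau>)}" using finite_subset by blast
  then have "finite (\<Union>i\<in>insert j J. {\<tau>. \<not> Q i (L \<tau>)})" using fin insert.hyps by auto
  then obtain \<tau> where "\<tau> \<notin> (\<Union>i\<in>insert j J. {\<tau>. \<not> Q i (L \<tau>)})"
    using ex_new_if_finite infinite_UNIV_char_0 by blast
  then show ?case by blast
qed simp

text \<open>Along a line \<open>f\<close> is affine, so two zeros would force it to vanish
  throughout, contradicting \<open>f w \<noteq> 0\<close>.\<close>

lemma generic_prop_nonzero:
  fixes f :: "('a \<Rightarrow> 'b::real_vector) \<Rightarrow> 'c::real_vector"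
  assumes "\<And>w w' \<tau>. f (\<lambda>i. w i + \<tau> *\<^sub>R (w' i - w i)) = f w + \<tau> *\<^sub>R (f w' - f w)"
  shows "generic_prop (\<lambda>w. f w \<noteq> 0)"
  unfolding generic_prop_def
proof (intro allI impI)
  fix w w' :: "'a \<Rightarrow> 'b" assume w: "f w \<noteq> 0"
  have "\<tau> = \<sigma>" if "f w + \<tau> *\<^sub>R (f w' - f w) = 0" "f w + \<sigma> *\<^sub>R (f w' - f w) = 0" for \<tau> \<sigma>
  proof -
    have "\<tau> *\<^sub>R (f w' - f w) = \<sigma> *\<^sub>R (f w' - f w)" using that by (metis add_left_cancel)
    moreover have "f w' - f w \<noteq> 0" using that w by auto
    ultimately show ?thesis by simp
  qed
  then have "\<exists>\<tau>. {\<tau>. f w + \<tau> *\<^sub>R (f w' - f w) = 0} \<subseteq> {\<tau>}" by blast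
  then show "finite {\<tau>. \<not> f (\<lambda>i. w i + \<tau> *\<^sub>R (w' i - w i)) \<noteq> 0}"
    unfolding assms by (auto intro: finite_subset)
qed

text \<open>The pivot entry is a polynomial with finitely many roots; away from them one row can be
  eliminated. Elimination raises degrees, hence entries of arbitrary degree.\<close>

lemma finite_dependent_poly_rows:
  assumes "finite S" "rows_indep S K (\<lambda>e k. poly (u e k) \<tau>0)"
  shows "finite {\<tau>. \<not> rows_indep S K (\<lambda>e k. poly (u e k) \<tau>)}"
  using assms
proof (induction S arbitrary: u rule: finite_induct)
  case empty
  then show ?case by (simp add: rows_indep_def)
next
  case (insert e S)
  obtain k0 where k0: "k0 \<in> K" "poly (u e k0) \<tau>0 \<noteq> 0"
    using rows_indep_nonzero[OF insert.prems(1)] insert.hyps by blast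
  let ?v = "\<lambda>f k. u e k0 * u f k - u f k0 * u e k"
  have piv: "rows_indep (insert e S) K (\<lambda>e k. poly (u e k) \<tau>) \<longleftrightarrow>
        rows_indep S K (\<lambda>f k. poly (?v f k) \<tau>)" if "poly (u e k0) \<tau> \<noteq> 0" for \<tau>
    using rows_indep_pivot[of S e k0 K "\<lambda>e k. poly (u e k) \<tau>"] insert.hyps k0 that by simp
  have "finite {\<tau>. \<not> rows_indep S K (\<lambda>f k. poly (?v f k) \<tau>)}"
    by (rule insert.IH) (use insert.prems piv[OF k0(2)] in blast)
  moreover have "finite {\<tau>. poly (u e k0) \<tau> = 0}"
    using k0 by (intro poly_roots_finite) auto
  moreover have "{\<tau>. \<not> rows_indep (insert e S) K (\<lambda>e k. poly (u e k) \<tau>)}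
     \<subseteq> {\<tau>. \<not> rows_indep S K (\<lambda>f k. poly (?v f k) \<tau>)} \<union> {\<tau>. poly (u e k0) \<tau> = 0}"
    using piv by blast
  ultimately show ?case using finite_subset by blast
qed

lemma generic_prop_rows_indep:
  fixes v :: "('a \<Rightarrow> 'b::real_vector) \<Rightarrow> 'e \<Rightarrow> 'k \<Rightarrow> real"
  assumes "finite S"
    and aff: "\<And>w w' \<tau> e k. v (\<lambda>i. w i + \<tau> *\<^sub>R (w' i - w i)) e k = v w e k + \<tau> * (v w' e k - v w e k)"
  shows "generic_prop (\<lambda>w. rows_indep S K (v w))"
  unfolding generic_prop_def
proof (intro allI impI)
  fix w w' assume w: "rows_indep S K (v w)"
  define u where "u = (\<lambda>e k. [:v w e k, v w' e k - v w e k:])"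
  have u: "v (\<lambda>i. w i + \<tau> *\<^sub>R (w' i - w i)) = (\<lambda>e k. poly (u e k) \<tau>)" for \<tau>
    by (intro ext) (simp add: aff u_def)
  have "rows_indep S K (\<lambda>e k. poly (u e k) 0)" using w by (simp add: u_def)
  then show "finite {\<tau>. \<not> rows_indep S K (v (\<lambda>i. w i + \<tau> *\<^sub>R (w' i - w i)))}"
    unfolding u by (rule finite_dependent_poly_rows[OF assms(1)])
qed

section \<open>Sparse graphs have independent rigidity rows\<close>

text \<open>A row of the rigidity matrix with the edge vector replaced by a free direction
  \<open>x\<close>; a column is a vertex with a coordinate. This separates the choice of directions
  from that of positions.\<close>

definition edge_row :: "'w \<Rightarrow> 'w \<Rightarrow> real^2 \<Rightarrow> 'w \<times> 2 \<Rightarrow> real" where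
  "edge_row u v x k = x $ snd k * (of_bool (fst k = u) - of_bool (fst k = v))"

lemma edge_row_affine:
  "edge_row u v (x + \<tau> *\<^sub>R (y - x)) k = edge_row u v x k + \<tau> * (edge_row u v y k - edge_row u v x k)"
  by (simp add: edge_row_def algebra_simps)

lemma edge_row_scaleR: "edge_row u v (c *\<^sub>R x) k = c * edge_row u v x k"
  by (simp add: edge_row_def)

text \<open>Endpoints may lie outside \<open>X\<close> where \<open>h\<close> vanishes; this is how
  pins are treated.\<close>

lemma sum_edge_row:
  assumes "finite X" "u \<in> X \<or> h u = 0" "v \<in> X \<or> h v = 0"
  shows "(\<Sum>k\<in>X \<times> UNIV. edge_row u v x k * h (fst k) $ snd k) = x \<bullet> (h u - h v)"
proof -
  have one: "(\<Sum>i\<in>X. of_bool (i = z) * (x \<bullet> h i)) = x \<bullet> h z" if "z \<in> X \<or> h z = 0" for z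
    using assms(1) that by (auto simp: of_bool_def if_distrib[of "\<lambda>r. r * _"] cong: if_cong)
  have "(\<Sum>k\<in>X \<times> UNIV. edge_row u v x k * h (fst k) $ snd k)
      = (\<Sum>i\<in>X. \<Sum>d\<in>UNIV. edge_row u v x (i, d) * h i $ d)"
    by (simp add: sum.cartesian_product case_prod_unfold)
  also have "\<dots> = (\<Sum>i\<in>X. (of_bool (i = u) - of_bool (i = v)) * (x \<bullet> h i))"
    by (rule sum.cong) (simp_all add: edge_row_def inner_vec_def sum_distrib_left algebra_simps)
  also have "\<dots> = x \<bullet> h u - x \<bullet> h v"
    using one assms(2,3) by (simp add: left_diff_distrib sum_subtractf)
  finally show ?thesis by (simp add: inner_diff_right)
qed

text \<open>In a minimal dependent set C of a generic choice x, a row of C may be replaced by any other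
  vector supported on the same edge without leaving the span of the remaining rows. Hence that span
  contains every vector supported on a connected component of C, and has dimension at
  least 2|V(C)| - 2.\<close>

lemma generic_edge_rows_indep:
  fixes a b :: "'c \<Rightarrow> 'w" and x :: "'c \<Rightarrow> real^2"
  assumes fin: "finite S" and ends: "edge_verts S a b \<subseteq> X"
    and gen: "\<And>F y. F \<subseteq> S \<Longrightarrow> rows_indep F (X \<times> UNIV) (\<lambda>e. edge_row (a e) (b e) (y e)) \<Longrightarrow>
                  rows_indep F (X \<times> UNIV) (\<lambda>e. edge_row (a e) (b e) (x e))"
    and sparse: "\<And>F. F \<subseteq> S \<Longrightarrow> F \<noteq> {} \<Longrightarrow> int (card F) \<le> 2 * int (card (edge_verts F a b)) - 2"
  shows "rows_indep S (X \<times> UNIV) (\<lambda>e. edge_row (a e) (b e) (x e))"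
proof (rule ccontr)
  define K where "K = X \<times> (UNIV :: 2 set)"
  define u where "u = (\<lambda>e. edge_row (a e) (b e) (x e))"
  assume S_dep: "\<not> rows_indep S (X \<times> UNIV) (\<lambda>e. edge_row (a e) (b e) (x e))"
  define Dep where "Dep = {C. C \<subseteq> S \<and> \<not> rows_indep C K u}"
  have "finite Dep" using fin by (simp add: Dep_def)
  moreover have "S \<in> Dep"
    using S_dep by (simp add: Dep_def K_def u_def)
  then have "Dep \<noteq> {}" by blast
  ultimately obtain C where C: "C \<in> Dep" and min: "\<And>D. D \<in> Dep \<Longrightarrow> D \<subseteq> C \<Longrightarrow> C = D"
    using finite_has_minimal[of Dep] by blast
  have CS: "C \<subseteq> S" and dep: "\<not> rows_indep C K u" using C by (auto simp: Dep_def)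
  have minC: "rows_indep D K u" if "D \<subset> C" for D using min[of D] that CS by (auto simp: Dep_def)
  have finC: "finite C" using CS fin finite_subset by blast
  have "C \<noteq> {}" using dep by (auto simp: rows_indep_def)
  then obtain c0 where c0: "c0 \<in> C" by blast
  define T where "T = in_row_span (C - {c0}) K u"
  \<comment> \<open>Were \<open>C\<close> independent with direction \<open>z\<close> at
    \<open>c\<close>, genericity would make it independent for \<open>x\<close> as well. So the
    changed row still depends on the others.\<close>
  have absorb: "in_row_span (C - {c}) K u (edge_row (a c) (b c) z)" if c: "c \<in> C" for c z
  proof -
    define y where "y = x(c := z)"
    define u' where "u' = (\<lambda>e. edge_row (a e) (b e) (y e))"
    have eq: "u' e k = u e k" if "e \<in> C - {c}" for e k using that by (simp add: u'_def u_def y_def)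
    have "\<not> rows_indep C K u'" using gen[OF CS, of y] dep by (auto simp: u'_def u_def K_def)
    then have "\<not> rows_indep (insert c (C - {c})) K u'" using c by (simp add: insert_absorb)
    moreover have "rows_indep (C - {c}) K u'"
      using minC[of "C - {c}"] c rows_indep_cong[of "C - {c}" K u' u] eq by blast
    ultimately have "in_row_span (C - {c}) K u' (u' c)"
      using dependent_row_in_span[of "C - {c}" c K u'] finC by blast
    then have "in_row_span (C - {c}) K u (u' c)" unfolding in_row_span_def using eq by simp
    then show ?thesis by (simp add: u'_def y_def)
  qed
  have Tu: "T (u c)" if "c \<in> C" for c
    using that absorb[OF c0, of "x c0"] in_row_span_base[of "C - {c0}" c K u] finC
    by (cases "c = c0") (auto simp: T_def u_def)
  have T_edge: "T (edge_row (a c) (b c) z)" if c: "c \<in> C" for c z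
  proof -
    obtain M where M: "\<And>k. k \<in> K \<Longrightarrow> edge_row (a c) (b c) z k = (\<Sum>e\<in>C - {c}. M e * u e k)"
      using absorb[OF c] unfolding in_row_span_def by blast
    have "T (\<lambda>k. \<Sum>e\<in>C - {c}. M e * u e k)"
      unfolding T_def by (rule in_row_span_lincomb) (use Tu in \<open>auto simp: T_def\<close>)
    then show ?thesis unfolding T_def by (rule in_row_span_cong) (simp add: M)
  qed
  \<comment> \<open>The unit vector of column \<open>(v, d)\<close> minus that of column
    \<open>(w, d)\<close>.\<close>
  define \<delta> where "\<delta> = (\<lambda>(v::'w) w (d::2) k. edge_row v w (axis d 1) k)"
  have \<delta>_trans: "T (\<delta> v w d)" if "T (\<delta> v z d)" "T (\<delta> z w d)" for v z w d
    using in_row_span_cong[OF in_row_span_add[OF that[unfolded T_def]]]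
    by (simp add: T_def \<delta>_def edge_row_def algebra_simps)
  have \<delta>_sym: "T (\<delta> w v d)" if "T (\<delta> v w d)" for v w d
    using in_row_span_cong[OF in_row_span_uminus[OF that[unfolded T_def]]]
    by (simp add: T_def \<delta>_def edge_row_def algebra_simps)
  have \<delta>_edge: "T (\<delta> (a c) (b c) d)" if "c \<in> C" for c d
    using T_edge[OF that] by (simp add: \<delta>_def)
  define \<rho> where "\<rho> = a c0"
  define V where "V = edge_verts C a b"
  \<comment> \<open>Vertices linked to \<open>\<rho>\<close> through the span: closed under the
    edges of \<open>C\<close>, so \<open>R\<close> contains the component of
    \<open>\<rho>\<close>.\<close>
  define R where "R = {v. \<forall>d. T (\<delta> v \<rho> d)}"
  have finV: "finite V" using finC by (simp add: V_def edge_verts_def)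
  have VX: "V \<subseteq> X" using ends CS unfolding V_def edge_verts_def by blast
  have \<rho>V: "\<rho> \<in> V" using c0 by (auto simp: \<rho>_def V_def edge_verts_def)
  have "T (\<lambda>k. 0)" using in_row_span_lincomb[of "{}" "C - {c0}" K u] by (simp add: T_def)
  then have \<rho>R: "\<rho> \<in> R" by (simp add: R_def \<delta>_def edge_row_def)
  have R_edge: "a c \<in> R \<longleftrightarrow> b c \<in> R" if "c \<in> C" for c
    unfolding R_def using \<delta>_trans \<delta>_sym \<delta>_edge[OF that] by blast
  show False
  proof (cases "V \<subseteq> R")
    case True
    \<comment> \<open>These give \<open>2 * (card V - 1)\<close> independent vectors in the span of
      \<open>card C - 1\<close> rows, against the sparsity bound.\<close>
    define J where "J = (V - {\<rho>}) \<times> (UNIV :: 2 set)"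
    define w where "w = (\<lambda>j k. \<delta> (fst j) \<rho> (snd j) k)"
    have finJ: "finite J" using finV by (simp add: J_def)
    have indepJ: "rows_indep J K w"
    proof (rule rows_indepI)
      fix c j assume c: "\<And>k. k \<in> K \<Longrightarrow> (\<Sum>j\<in>J. c j * w j k) = 0" and j: "j \<in> J"
      have "w i j = of_bool (i = j)" if "i \<in> J" for i
        using that j by (auto simp: w_def \<delta>_def edge_row_def J_def axis_def prod_eq_iff)
      then have "(\<Sum>i\<in>J. c i * w i j) = (\<Sum>i\<in>J. if i = j then c i else 0)"
        by (intro sum.cong) auto
      moreover have "j \<in> K" using j VX by (auto simp: J_def K_def)
      ultimately show "c j = 0" using c[of j] j finJ by simp
    qed
    have "card J \<le> card (C - {c0})"
      by (rule rows_indep_in_span_card_le[OF _ finJ indepJ, where u = u])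
        (use finC True in \<open>auto simp: J_def w_def R_def T_def\<close>)
    moreover have "card J = 2 * (card V - 1)"
      using \<rho>V finV by (simp add: J_def card_cartesian_product)
    moreover have "card V > 0" using \<rho>V finV card_gt_0_iff by blast
    moreover have "card C > 0" using c0 finC card_gt_0_iff by blast
    moreover have "int (card C) \<le> 2 * int (card V) - 2"
      using sparse[OF CS] \<open>C \<noteq> {}\<close> by (simp add: V_def)
    ultimately show False using c0 finC by simp
  next
    case False
    \<comment> \<open>No edge of \<open>C\<close> leaves \<open>R\<close>, so a dependency restricts
      to \<open>C1\<close>; minimality forces it to vanish at \<open>c0\<close> and then
      everywhere.\<close>
    define C1 where "C1 = {c\<in>C. a c \<in> R}"
    have "C1 \<subset> C" using False R_edge by (auto simp: C1_def V_def edge_verts_def)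
    have c01: "c0 \<in> C1" using c0 \<rho>R by (simp add: C1_def \<rho>_def)
    obtain l f where l: "\<And>k. k \<in> K \<Longrightarrow> (\<Sum>e\<in>C. l e * u e k) = 0" and f: "f \<in> C" "l f \<noteq> 0"
      using dep unfolding rows_indep_def by blast
    have "(\<Sum>e\<in>C1. l e * u e k) = 0" if k: "k \<in> K" for k
    proof (cases "fst k \<in> R")
      case True
      have "(\<Sum>e\<in>C1. l e * u e k) = (\<Sum>e\<in>C. l e * u e k)"
        by (rule sum.mono_neutral_left)
          (use finC True R_edge in \<open>auto simp: C1_def u_def edge_row_def\<close>)
      then show ?thesis using l[OF k] by simp
    next
      case False
      show ?thesis
        by (rule sum.neutral) (use False R_edge in \<open>auto simp: C1_def u_def edge_row_def\<close>)
    qed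
    then have "l c0 = 0" using rows_indepD[OF minC[OF \<open>C1 \<subset> C\<close>], of l c0] c01 by blast
    then have "(\<Sum>e\<in>C - {c0}. l e * u e k) = 0" if "k \<in> K" for k
      using l[OF that] c0 finC by (simp add: sum.remove[of C c0])
    then have "l e = 0" if "e \<in> C - {c0}" for e
      using rows_indepD[OF minC[of "C - {c0}"], of l e] c0 that by blast
    then show False using f \<open>l c0 = 0\<close> by blast
  qed
qed

section \<open>The quarter turn of the plane\<close>

definition rot :: "real^2 \<Rightarrow> real^2" where
  "rot x = vector [- (x $ 2), x $ 1]"

lemma rot_nth [simp]: "rot x $ 1 = - (x $ 2)" "rot x $ 2 = x $ 1"
  by (simp_all add: rot_def)

lemma rot_diff: "rot (x - y) = rot x - rot y"
  by (simp add: vec_eq_iff forall_2)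

lemma rot_zero [simp]: "rot 0 = 0"
  by (simp add: vec_eq_iff forall_2)

lemma rot_rot [simp]: "rot (rot x) = - x"
  by (simp add: vec_eq_iff forall_2)

lemma rot_scaleR: "rot (c *\<^sub>R x) = c *\<^sub>R rot x"
  by (simp add: vec_eq_iff forall_2)

lemma inner_vec2: "(x::real^2) \<bullet> y = x $ 1 * y $ 1 + x $ 2 * y $ 2"
  by (simp add: inner_vec_def sum_2)

lemma inner_rot_self [simp]: "x \<bullet> rot x = 0"
  by (simp add: inner_vec2)

lemma inner_rot_rot: "rot x \<bullet> rot y = x \<bullet> y"
  by (simp add: inner_vec2)

lemma orthogonal_imp_rot_multiple:
  assumes "x \<bullet> y = 0" "y \<noteq> 0"
  obtains c where "x = c *\<^sub>R rot y"
proof -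
  have n: "y $ 1 * y $ 1 + y $ 2 * y $ 2 \<noteq> 0"
    using assms(2) inner_eq_zero_iff[of y] by (simp add: inner_vec2)
  \<comment> \<open>The coefficient is \<open>x \<bullet> rot y\<close> over the squared norm of
    \<open>y\<close>.\<close>
  have "x = ((x $ 2 * y $ 1 - x $ 1 * y $ 2) / (y $ 1 * y $ 1 + y $ 2 * y $ 2)) *\<^sub>R rot y"
    using assms(1) n by (simp add: vec_eq_iff forall_2 inner_vec2 field_simps) algebra
  then show ?thesis using that by blast
qed

text \<open>Doubling an edge of a Laman-sparse graph leaves room for one more independent direction on
  that edge. Hence some h is orthogonal to a generic direction on each edge without collapsing any
  edge, and the edges of h are then parallel to the rotated directions.\<close>

theorem laman_sparse_rows_indep:
  fixes a b :: "'e \<Rightarrow> 'w"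
  assumes fin: "finite E"
    and sparse: "\<And>F. F \<subseteq> E \<Longrightarrow> F \<noteq> {} \<Longrightarrow> int (card F) \<le> 2 * int (card (edge_verts F a b)) - 3"
    and X: "finite X" "edge_verts E a b \<subseteq> X"
  shows "\<exists>q. rows_indep E (X \<times> UNIV) (\<lambda>e. edge_row (a e) (b e) (q (a e) - q (b e)))"
proof -
  \<comment> \<open>Two copies of every edge, so that one edge can carry two independently chosen
    directions.\<close>
  define S where "S = E \<times> (UNIV :: bool set)"
  define K where "K = X \<times> (UNIV :: 2 set)"
  define r where "r = (\<lambda>y (c::'e \<times> bool). edge_row (a (fst c)) (b (fst c)) (y c :: real^2))"
  \<comment> \<open>One \<open>x\<close> for all realizable subsets at once supplies the genericity
    hypothesis of \<open>generic_edge_rows_indep\<close>.\<close>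
  define Good where "Good = {F. F \<subseteq> S \<and> (\<exists>y. rows_indep F K (r y))}"
  have finS: "finite S" using fin by (simp add: S_def)
  have finK: "finite K" using X by (simp add: K_def)
  have "\<exists>x. \<forall>F\<in>Good. rows_indep F K (r x)"
  proof (rule generic_prop_common)
    show "finite Good" using finS by (simp add: Good_def)
    show "generic_prop (\<lambda>x. rows_indep F K (r x))" if "F \<in> Good" for F
      by (rule generic_prop_rows_indep)
        (use that finS in \<open>auto simp: Good_def r_def edge_row_affine intro: finite_subset\<close>)
  qed (auto simp: Good_def)
  then obtain x where x: "\<And>F y. F \<subseteq> S \<Longrightarrow> rows_indep F K (r y) \<Longrightarrow> rows_indep F K (r x)"
    unfolding Good_def by blast
  define D where "D = (\<lambda>e. insert (e, False) (E \<times> {True}))"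
  have DS: "D e \<subseteq> S" if "e \<in> E" for e using that by (auto simp: D_def S_def)
  have indep: "rows_indep (D e) K (r x)" if e: "e \<in> E" for e
    unfolding K_def r_def
  proof (rule generic_edge_rows_indep)
    show "finite (D e)" using fin by (simp add: D_def)
    show "edge_verts (D e) (\<lambda>c. a (fst c)) (\<lambda>c. b (fst c)) \<subseteq> X"
      using X(2) e by (auto simp: D_def edge_verts_def)
  next
    fix F y assume "F \<subseteq> D e"
      "rows_indep F (X \<times> UNIV) (\<lambda>c. edge_row (a (fst c)) (b (fst c)) (y c))"
    then show "rows_indep F (X \<times> UNIV) (\<lambda>c. edge_row (a (fst c)) (b (fst c)) (x c))"
      using x[of F y] DS[OF e] by (auto simp: K_def r_def)
  next
    fix F assume F: "F \<subseteq> D e" "F \<noteq> {}"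
    have finF: "finite (fst ` F)" using F fin by (auto simp: D_def intro: finite_subset)
    \<comment> \<open>Only \<open>e\<close> is doubled, which turns the bound with -3 into one with
      -2.\<close>
    have "F \<subseteq> insert (e, False) (fst ` F \<times> {True})" using F by (force simp: D_def)
    then have "card F \<le> card (insert (e, False) (fst ` F \<times> {True}))"
      using finF by (intro card_mono) auto
    also have "\<dots> \<le> Suc (card (fst ` F))"
      using finF by (simp add: card_insert_if card_cartesian_product)
    finally have "card F \<le> Suc (card (fst ` F))" .
    moreover have "int (card (fst ` F)) \<le> 2 * int (card (edge_verts (fst ` F) a b)) - 3"
      by (rule sparse) (use F e in \<open>auto simp: D_def\<close>)
    moreover have "edge_verts F (\<lambda>c. a (fst c)) (\<lambda>c. b (fst c)) = edge_verts (fst ` F) a b"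
      by (simp add: edge_verts_def image_image)
    ultimately show "int (card F) \<le> 2 * int (card (edge_verts F (\<lambda>c. a (fst c)) (\<lambda>c. b (fst c)))) - 2"
      by simp
  qed
  have ex_h: "\<exists>h :: 'w \<Rightarrow> real^2. (\<forall>f\<in>E. x (f, True) \<bullet> (h (a f) - h (b f)) = 0) \<and>
          h (a e) - h (b e) \<noteq> 0" if e: "e \<in> E" for e
  proof -
    have "finite (D e)" using fin by (simp add: D_def)
    \<comment> \<open>Value 0 on the \<open>True\<close> copies gives orthogonality; value 1 on the
      extra copy of \<open>e\<close> keeps \<open>h\<close> from collapsing that edge.\<close>
    from rows_indep_surj[OF this finK indep[OF e], of "\<lambda>c. of_bool (c = (e, False))"]
    obtain g where g: "\<And>c. c \<in> D e \<Longrightarrow> (\<Sum>k\<in>K. r x c k * g k) = of_bool (c = (e, False))" by blast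
    define h :: "'w \<Rightarrow> real^2" where "h = (\<lambda>v. \<chi> d. g (v, d))"
    have ip: "x c \<bullet> (h (a (fst c)) - h (b (fst c))) = of_bool (c = (e, False))" if "c \<in> D e" for c
    proof -
      have "fst c \<in> E" using that e by (auto simp: D_def)
      then have "a (fst c) \<in> X" "b (fst c) \<in> X" using X(2) by (auto simp: edge_verts_def)
      then have "x c \<bullet> (h (a (fst c)) - h (b (fst c)))
          = (\<Sum>k\<in>K. r x c k * h (fst k) $ snd k)"
        using sum_edge_row[OF X(1), of "a (fst c)" h "b (fst c)" "x c"] by (simp add: K_def r_def)
      then show ?thesis using g[OF that] by (simp add: h_def)
    qed
    have "x (f, True) \<bullet> (h (a f) - h (b f)) = 0" if "f \<in> E" for f
      using ip[of "(f, True)"] that by (simp add: D_def)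
    moreover have "x (e, False) \<bullet> (h (a e) - h (b e)) = 1"
      using ip[of "(e, False)"] by (simp add: D_def)
    then have "h (a e) - h (b e) \<noteq> 0" by auto
    ultimately show ?thesis by blast
  qed
  then obtain H :: "'e \<Rightarrow> 'w \<Rightarrow> real^2" where
    H0: "\<And>e f. e \<in> E \<Longrightarrow> f \<in> E \<Longrightarrow> x (f, True) \<bullet> (H e (a f) - H e (b f)) = 0" and
    H1: "\<And>e. e \<in> E \<Longrightarrow> H e (a e) - H e (b e) \<noteq> 0"
    by metis
  \<comment> \<open>Each \<open>H e\<close> protects only its own edge; a generic combination
    protects all of them and remains orthogonal to the directions.\<close>
  define Hs where "Hs = (\<lambda>(w::'e \<Rightarrow> real) v. \<Sum>e\<in>E. w e *\<^sub>R H e v)"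
  have "\<exists>w. \<forall>e\<in>E. Hs w (a e) - Hs w (b e) \<noteq> 0"
  proof (rule generic_prop_common[OF fin])
    fix e assume e: "e \<in> E"
    show "generic_prop (\<lambda>w. Hs w (a e) - Hs w (b e) \<noteq> 0)"
      by (rule generic_prop_nonzero)
        (simp add: Hs_def scaleR_sum_right sum_subtractf[symmetric] sum.distrib[symmetric] algebra_simps)
    have "Hs (\<lambda>f. if f = e then 1 else 0) v = H e v" for v
      using e fin by (simp add: Hs_def if_distrib[of "\<lambda>r. r *\<^sub>R _"] cong: if_cong)
    then show "\<exists>w. Hs w (a e) - Hs w (b e) \<noteq> 0"
      using H1[OF e] by metis
  qed
  then obtain w where w: "\<And>e. e \<in> E \<Longrightarrow> Hs w (a e) - Hs w (b e) \<noteq> 0" by blast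
  define q where "q = (\<lambda>v. rot (Hs w v))"
  have "\<exists>c. x (e, True) = c *\<^sub>R (q (a e) - q (b e))" if e: "e \<in> E" for e
  proof -
    have "x (e, True) \<bullet> (Hs w (a e) - Hs w (b e))
        = (\<Sum>f\<in>E. w f * (x (e, True) \<bullet> (H f (a e) - H f (b e))))"
      by (simp add: Hs_def inner_sum_right inner_diff_right sum_subtractf right_diff_distrib)
    also have "\<dots> = 0" using H0 e by simp
    finally obtain c where "x (e, True) = c *\<^sub>R rot (Hs w (a e) - Hs w (b e))"
      using orthogonal_imp_rot_multiple w[OF e] by blast
    then show ?thesis by (auto simp: q_def rot_diff)
  qed
  then obtain c where c: "\<And>e. e \<in> E \<Longrightarrow> x (e, True) = c e *\<^sub>R (q (a e) - q (b e))" by metis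
  \<comment> \<open>Rescaled by \<open>c e\<close>, the rows of \<open>q\<close> become those of
    \<open>x\<close> on the \<open>True\<close> copies, which are independent.\<close>
  have "rows_indep E K (\<lambda>e k. c e * edge_row (a e) (b e) (q (a e) - q (b e)) k)"
  proof (cases "E = {}")
    case False
    then obtain e0 where e0: "e0 \<in> E" by blast
    have sub: "rows_indep (E \<times> {True}) K (r x)"
      by (rule rows_indep_subset[OF indep[OF e0]]) (use fin in \<open>auto simp: D_def\<close>)
    show ?thesis
    proof (rule rows_indepI)
      fix d e assume d: "\<And>k. k \<in> K \<Longrightarrow>
          (\<Sum>e\<in>E. d e * (c e * edge_row (a e) (b e) (q (a e) - q (b e)) k)) = 0" and e: "e \<in> E"
      have "(\<Sum>g\<in>E \<times> {True}. d (fst g) * r x g k)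
          = (\<Sum>e\<in>E. d e * (c e * edge_row (a e) (b e) (q (a e) - q (b e)) k))" for k
        by (rule sum.reindex_bij_witness[of _ "\<lambda>e. (e, True)" fst])
          (auto simp: r_def c edge_row_scaleR)
      then show "d e = 0"
        using rows_indepD[OF sub, of "\<lambda>g. d (fst g)" "(e, True)"] d e by simp
    qed
  qed (simp add: rows_indep_def)
  then show ?thesis unfolding K_def by (intro exI) (rule rows_indep_scaleD[OF _ fin])
qed

text \<open>Removing any edge of a circuit leaves a Laman-sparse graph. The finitely many row and
  separation conditions are generic, so one placement meets them all.\<close>

lemma rigidity_circuit_generic_placement:
  fixes a b :: "'e \<Rightarrow> 'w"
  assumes circ: "rigidity_circuit E a b" and X: "X = edge_verts E a b"
  shows "\<exists>q. inj_on q X \<and>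
    (\<forall>e0\<in>E. rows_indep (E - {e0}) (X \<times> UNIV) (\<lambda>e. edge_row (a e) (b e) (q (a e) - q (b e))))"
proof -
  define r where "r = (\<lambda>(q :: 'w \<Rightarrow> real^2) e. edge_row (a e) (b e) (q (a e) - q (b e)))"
  have fin: "finite E" using circ by (simp add: rigidity_circuit_def)
  then have finX: "finite X" by (simp add: X edge_verts_def)
  define J where "J = (\<lambda>e0 q. rows_indep (E - {e0}) (X \<times> UNIV) (r q)) ` E \<union>
     (\<lambda>(u, v) q. q u - q v \<noteq> 0) ` {(u, v) \<in> X \<times> X. u \<noteq> v}"
  have "\<exists>q. \<forall>Q\<in>J. Q q"
  proof (rule generic_prop_common)
    have "{(u, v) \<in> X \<times> X. u \<noteq> v} \<subseteq> X \<times> X" by blast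
    then have "finite {(u, v) \<in> X \<times> X. u \<noteq> v}" using finX by (meson finite_SigmaI finite_subset)
    then show "finite J" using fin by (simp add: J_def)
  next
    fix Q assume "Q \<in> J"
    then consider (row) e0 where "e0 \<in> E" "Q = (\<lambda>q. rows_indep (E - {e0}) (X \<times> UNIV) (r q))"
      | (sep) u v where "u \<noteq> v" "Q = (\<lambda>q. q u - q v \<noteq> 0)"
      unfolding J_def by blast
    then show "generic_prop Q"
    proof cases
      case row
      show ?thesis unfolding row(2)
        by (rule generic_prop_rows_indep) (use fin in \<open>auto simp: r_def edge_row_def algebra_simps\<close>)
    next
      case sep
      show ?thesis unfolding sep(2)
        by (rule generic_prop_nonzero) (simp add: algebra_simps)
    qed
  next
    fix Q assume "Q \<in> J"
    then consider (row) e0 where "e0 \<in> E" "Q = (\<lambda>q. rows_indep (E - {e0}) (X \<times> UNIV) (r q))"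
      | (sep) u v where "u \<noteq> v" "Q = (\<lambda>q. q u - q v \<noteq> 0)"
      unfolding J_def by blast
    then show "\<exists>q. Q q"
    proof cases
      case row
      show ?thesis unfolding row(2) r_def
      proof (rule laman_sparse_rows_indep)
        fix F assume F: "F \<subseteq> E - {e0}" "F \<noteq> {}"
        then have "F \<subset> E" using row(1) by blast
        then show "int (card F) \<le> 2 * int (card (edge_verts F a b)) - 3"
          using circ F(2) unfolding rigidity_circuit_def by blast
      qed (use fin finX in \<open>auto simp: X edge_verts_def\<close>)
    next
      case sep
      then show ?thesis by (intro exI[of _ "\<lambda>z. if z = u then axis 1 1 else 0"]) simp
    qed
  qed
  then obtain q where q: "\<And>Q. Q \<in> J \<Longrightarrow> Q q" by blast
  have "q u \<noteq> q v" if "u \<in> X" "v \<in> X" "u \<noteq> v" for u v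
  proof -
    have "(\<lambda>q. q u - q v \<noteq> 0) \<in> J" using that by (force simp: J_def)
    from q[OF this] show ?thesis by simp
  qed
  then have "inj_on q X" by (auto simp: inj_on_def)
  moreover have "rows_indep (E - {e0}) (X \<times> UNIV) (r q)" if "e0 \<in> E" for e0
    using q[of "\<lambda>q. rows_indep (E - {e0}) (X \<times> UNIV) (r q)"] that by (auto simp: J_def)
  ultimately show ?thesis unfolding r_def by blast
qed

text \<open>Signed incidences match the form of \<open>edge_row\<close>: seen from
  \<open>t e\<close>, the edge vector changes sign.\<close>

lemma self_stress_alt:
  assumes "finite E"
  shows "self_stress I E s t p \<omega> \<longleftrightarrow> (\<forall>e. e \<notin> E \<longrightarrow> \<omega> e = 0) \<and>
    (\<forall>i\<in>I. (\<Sum>e\<in>E. (\<omega> e * (of_bool (i = s e) - of_bool (i = t e))) *\<^sub>R (p (s e) - p (t e))) = 0)"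
proof -
  have "(\<Sum>e\<in>{e\<in>E. s e = i}. \<omega> e *\<^sub>R (p i - p (t e))) + (\<Sum>e\<in>{e\<in>E. t e = i}. \<omega> e *\<^sub>R (p i - p (s e)))
      = (\<Sum>e\<in>E. (\<omega> e * (of_bool (i = s e) - of_bool (i = t e))) *\<^sub>R (p (s e) - p (t e)))" for i
  proof -
    have "(\<Sum>e\<in>{e\<in>E. s e = i}. \<omega> e *\<^sub>R (p i - p (t e)))
        = (\<Sum>e\<in>E. (\<omega> e * of_bool (i = s e)) *\<^sub>R (p (s e) - p (t e)))"
      by (rule sum.mono_neutral_cong_left) (use assms in auto)
    moreover have "(\<Sum>e\<in>{e\<in>E. t e = i}. \<omega> e *\<^sub>R (p i - p (s e)))
        = (\<Sum>e\<in>E. - ((\<omega> e * of_bool (i = t e)) *\<^sub>R (p (s e) - p (t e))))"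
      by (rule sum.mono_neutral_cong_left) (use assms in \<open>auto simp: algebra_simps\<close>)
    ultimately show ?thesis
      by (simp add: sum.distrib[symmetric] right_diff_distrib scaleR_diff_left)
  qed
  then show ?thesis unfolding self_stress_def by simp
qed

section \<open>Singular configurations of Assur graphs\<close>

theorem theorem3p2:
  fixes I P :: "'v set" and E :: "'e set" and s t :: "'e \<Rightarrow> 'v"
  assumes "assur_graph I P E s t"
    and "planar (I \<union> P) E s t"
    and "planar (ident_pins P ` (I \<union> P)) E (ident_pins P \<circ> s) (ident_pins P \<circ> t)"
  shows "\<exists>p :: 'v \<Rightarrow> real^2. inj_on p P \<and>
     (\<exists>\<omega>. self_stress I E s t p \<omega> \<and> (\<forall>e\<in>E. \<omega> e \<noteq> 0) \<and>
        (\<forall>\<mu>. self_stress I E s t p \<mu> \<longrightarrow> (\<exists>c::real. \<mu> = (\<lambda>e. c * \<omega> e)))) \<and>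
     (\<exists>m. first_order_motion I E s t p m \<and> (\<forall>i\<in>I. m i \<noteq> 0) \<and>
        (\<forall>m'. first_order_motion I E s t p m' \<longrightarrow> (\<exists>c::real. m' = (\<lambda>v. c *\<^sub>R m v))))"
proof -

  \<comment> \<open>The identified graph and its vertices\<close>
  define a where "a = ident_pins P \<circ> s"
  define b where "b = ident_pins P \<circ> t"
  define X where "X = edge_verts E a b"
  have fin: "finite I" "finite P" "finite E" and disj: "I \<inter> P = {}"
    and ends: "\<And>e. e \<in> E \<Longrightarrow> s e \<in> I \<union> P \<and> t e \<in> I \<union> P \<and> s e \<noteq> t e \<and> (s e \<in> I \<or> t e \<in> I)"
    and cardE: "card E = 2 * card I" and circ: "rigidity_circuit E a b"
    using assms(1) unfolding assur_graph_def pinned_isostatic_def pinned_graph_def a_def b_def by auto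
  \<comment> \<open>No inner vertex is isolated and the merged pin is used, since the two edge
    counts give \<open>card X = card I + 1\<close>.\<close>
  have XI: "X = insert None (Some ` I)"
  proof (rule card_subset_eq)
    show "X \<subseteq> insert None (Some ` I)"
      using ends by (force simp: X_def edge_verts_def a_def b_def ident_pins_def)
    have "int (card E) = 2 * int (card X) - 2"
      using circ by (simp add: rigidity_circuit_def X_def)
    moreover have "card (insert None (Some ` I)) = Suc (card I)"
      using fin by (simp add: card_image)
    ultimately show "card X = card (insert None (Some ` I))" using cardE by simp
  qed (use fin in simp)
  then have "E \<noteq> {}" by (auto simp: X_def edge_verts_def)
  then obtain e0 where e0: "e0 \<in> E" by blast
  then obtain i0 where i0: "i0 \<in> I" using ends by blast

  \<comment> \<open>The model placement with all pins at the origin\<close>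
  obtain q :: "'v option \<Rightarrow> real^2" where q_inj: "inj_on q X" and
    q: "\<And>e. e \<in> E \<Longrightarrow> rows_indep (E - {e}) (X \<times> UNIV) (\<lambda>e. edge_row (a e) (b e) (q (a e) - q (b e)))"
    using rigidity_circuit_generic_placement[OF circ X_def] by blast
  \<comment> \<open>Translation puts the merged pin at the origin; the value 0 off \<open>I\<close>
    also lets \<open>Q\<close> serve later as a motion.\<close>
  define Q where "Q = (\<lambda>v. if v \<in> I then q (Some v) - q None else 0)"
  define x where "x = (\<lambda>e. Q (s e) - Q (t e))"
  define m where "m = (\<lambda>v. rot (Q v))"
  define K where "K = I \<times> (UNIV :: 2 set)"
  define u where "u = (\<lambda>e. edge_row (s e) (t e) (x e))"
  have finK: "finite K" and cardK: "card K = card E"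
    using fin cardE by (simp_all add: K_def card_cartesian_product)
  have Q_off: "Q v = 0" if "v \<notin> I" for v using that by (simp add: Q_def)
  have Q_nz: "Q v \<noteq> 0" if "v \<in> I" for v
    using that q_inj XI by (auto simp: Q_def inj_on_def)
  have x_q: "x e = q (a e) - q (b e)" if "e \<in> E" for e
    using ends[OF that] disj by (auto simp: x_def Q_def a_def b_def ident_pins_def)
  have x_nz: "x e \<noteq> 0" if e: "e \<in> E" for e
  proof -
    have "a e \<in> X" "b e \<in> X" using e by (auto simp: X_def edge_verts_def)
    moreover have "a e \<noteq> b e"
      using ends[OF e] disj by (auto simp: a_def b_def ident_pins_def)
    ultimately show ?thesis using q_inj x_q[OF e] by (auto simp: inj_on_def)
  qed
  have u_prod: "(\<Sum>k\<in>K. u e k * h (fst k) $ snd k) = x e \<bullet> (h (s e) - h (t e))"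
    if "\<And>v. v \<notin> I \<Longrightarrow> h v = 0" for h e
    unfolding K_def u_def using that fin by (intro sum_edge_row) auto

  \<comment> \<open>Deleting the columns of \<open>None\<close> keeps independence: in each
    coordinate the entries of a row sum to zero, so a combination vanishing on \<open>I\<close>
    vanishes there as well.\<close>
  have indep: "rows_indep (E - {e}) K u" if e: "e \<in> E" for e
  proof (rule rows_indepI)
    fix c f assume c: "\<And>k. k \<in> K \<Longrightarrow> (\<Sum>f\<in>E - {e}. c f * u f k) = 0" and f: "f \<in> E - {e}"
    define r where "r = (\<lambda>e. edge_row (a e) (b e) (q (a e) - q (b e)))"
    define W where "W = (\<lambda>k. \<Sum>f\<in>E - {e}. c f * r f k)"
    have ru: "r g (Some i, d) = u g (i, d)" if "g \<in> E" "i \<in> I" for g i d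
      using that disj ends[OF that(1)] x_q[OF that(1)]
      by (auto simp: r_def u_def edge_row_def a_def b_def ident_pins_def)
    have WI: "W (Some i, d) = 0" if "i \<in> I" for i d
    proof -
      have "W (Some i, d) = (\<Sum>f\<in>E - {e}. c f * u f (i, d))"
        unfolding W_def by (rule sum.cong) (use ru that in auto)
      then show ?thesis using c[of "(i, d)"] that by (simp add: K_def)
    qed
    have r_sum: "(\<Sum>v\<in>X. r g (v, d)) = 0" if "g \<in> E" for g d
    proof -
      have one: "(\<Sum>v\<in>X. of_bool (v = z)) = (1::real)" if "z \<in> X" for z
        using that fin XI by (simp add: of_bool_def)
      have "(\<Sum>v\<in>X. r g (v, d)) = (q (a g) - q (b g)) $ d *
          ((\<Sum>v\<in>X. of_bool (v = a g)) - (\<Sum>v\<in>X. of_bool (v = b g)))"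
        by (simp only: r_def edge_row_def fst_conv snd_conv sum_distrib_left[symmetric] sum_subtractf)
      moreover have "a g \<in> X" "b g \<in> X" using that by (auto simp: X_def edge_verts_def)
      ultimately show ?thesis using one by simp
    qed
    have "W (None, d) = 0" for d
    proof -
      have "(\<Sum>v\<in>X. W (v, d)) = (\<Sum>f\<in>E - {e}. c f * (\<Sum>v\<in>X. r f (v, d)))"
        unfolding W_def by (subst sum.swap) (simp add: sum_distrib_left)
      also have "\<dots> = 0" using r_sum by simp
      finally have "(\<Sum>v\<in>X. W (v, d)) = 0" .
      moreover have "(\<Sum>v\<in>X. W (v, d)) = W (None, d) + (\<Sum>v\<in>Some ` I. W (v, d))"
        unfolding XI using fin by (subst sum.insert) auto
      moreover have "(\<Sum>v\<in>Some ` I. W (v, d)) = 0" by (rule sum.neutral) (use WI in auto)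
      ultimately show ?thesis by simp
    qed
    then have "W k = 0" if "k \<in> X \<times> UNIV" for k using that WI XI by auto
    then show "c f = 0"
      using rows_indepD[OF q[OF e], of c f] f unfolding W_def r_def by blast
  qed

  \<comment> \<open>Kernel and dependency of the model rows\<close>
  have m_off: "m v = 0" if "v \<notin> I" for v using Q_off[OF that] by (simp add: m_def)
  have m_diff: "m (s e) - m (t e) = rot (x e)" for e by (simp add: m_def x_def rot_diff)
  have m_ker: "(\<Sum>k\<in>K. u e k * m (fst k) $ snd k) = 0" for e
    using u_prod[of m e, OF m_off] by (simp add: m_diff)
  have "m i0 \<noteq> 0"
  proof
    assume "m i0 = 0"
    then have "rot (m i0) = 0" by simp
    then show False using Q_nz[OF i0] by (simp add: m_def)
  qed
  then obtain d0 where "m i0 $ d0 \<noteq> 0" by (auto simp: vec_eq_iff)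
  then have k0: "(i0, d0) \<in> K" "m (fst (i0, d0)) $ snd (i0, d0) \<noteq> 0" using i0 by (auto simp: K_def)

  \<comment> \<open>The matrix is square and \<open>m\<close> is a nonzero kernel vector.\<close>
  have "\<not> rows_indep E K u"
    using rows_indep_kernel_trivial[of E K u "\<lambda>k. m (fst k) $ snd k" "(i0, d0)"]
      fin finK cardK m_ker k0 by auto
  then obtain \<omega> f0 where \<omega>: "\<And>k. k \<in> K \<Longrightarrow> (\<Sum>e\<in>E. \<omega> e * u e k) = 0"
    and f0: "f0 \<in> E" "\<omega> f0 \<noteq> 0"
    unfolding rows_indep_def by blast
  \<comment> \<open>A dependency vanishing at one edge lives on the remaining edges, whose rows are
    independent.\<close>
  have dep_zero: "\<mu> f = 0" if "\<And>k. k \<in> K \<Longrightarrow> (\<Sum>e\<in>E. \<mu> e * u e k) = 0" "e \<in> E" "\<mu> e = 0" "f \<in> E"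
    for \<mu> e f
  proof -
    have "(\<Sum>e\<in>E - {e}. \<mu> e * u e k) = 0" if "k \<in> K" for k
      using \<open>\<And>k. k \<in> K \<Longrightarrow> (\<Sum>e\<in>E. \<mu> e * u e k) = 0\<close>[OF that] \<open>e \<in> E\<close> \<open>\<mu> e = 0\<close> fin
      by (simp add: sum.remove[of E e])
    then show ?thesis
      using rows_indepD[OF indep[OF \<open>e \<in> E\<close>], of \<mu> f] that(3,4) by (cases "f = e") auto
  qed
  have \<omega>_nz: "\<omega> e \<noteq> 0" if "e \<in> E" for e using dep_zero[OF \<omega> that _ f0(1)] f0(2) by blast
  have dep_line: "\<exists>c. \<forall>e\<in>E. \<mu> e = c * \<omega> e" if \<mu>: "\<And>k. k \<in> K \<Longrightarrow> (\<Sum>e\<in>E. \<mu> e * u e k) = 0" for \<mu>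
  proof -
    define c where "c = \<mu> e0 / \<omega> e0"
    have "(\<Sum>e\<in>E. (\<mu> e - c * \<omega> e) * u e k) = 0" if "k \<in> K" for k
    proof -
      have "(\<Sum>e\<in>E. (\<mu> e - c * \<omega> e) * u e k) = (\<Sum>e\<in>E. \<mu> e * u e k) - c * (\<Sum>e\<in>E. \<omega> e * u e k)"
        by (simp add: left_diff_distrib sum_subtractf sum_distrib_left mult.assoc)
      then show ?thesis using \<mu> \<omega> that by simp
    qed
    then have "\<mu> e - c * \<omega> e = 0" if "e \<in> E" for e
      using dep_zero[of "\<lambda>e. \<mu> e - c * \<omega> e" e0 e] e0 that \<omega>_nz[OF e0] by (simp add: c_def)
    then show ?thesis by (intro exI[of _ c]) simp
  qed

  \<comment> \<open>Prescribed pin positions extend to a placement with edge directions orthogonal to x iff one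
    linear condition, given by the dependency of the rows, holds. Collinear pins can always be
    turned so as to satisfy it.\<close>
  obtain n :: "'v \<Rightarrow> nat" where n: "inj_on n P"
    using finite_imp_inj_to_nat_seg[OF fin(2)] by blast
  define \<alpha> where "\<alpha> = (\<lambda>v. if v \<in> P then real (n v) else 0)"
  \<comment> \<open>For pins at \<open>\<alpha> v *\<^sub>R z\<close> the linear condition becomes
    \<open>B \<bullet> z = 0\<close>, which \<open>rot B\<close> or, if \<open>B = 0\<close>, any
    vector solves.\<close>
  define B where "B = (\<Sum>e\<in>E. (\<omega> e * (\<alpha> (s e) - \<alpha> (t e))) *\<^sub>R x e)"
  obtain z :: "real^2" where z: "z \<noteq> 0" "B \<bullet> z = 0"
  proof (cases "B = 0")
    case True
    then show ?thesis using that[of "axis 1 1"] by simp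
  next
    case False
    have "rot B \<noteq> 0"
    proof
      assume "rot B = 0"
      then have "rot (rot B) = 0" by simp
      then show False using False by simp
    qed
    then show ?thesis using that[of "rot B"] by simp
  qed
  define \<pi> where "\<pi> = (\<lambda>v. \<alpha> v *\<^sub>R z)"
  have \<pi>_bal: "(\<Sum>e\<in>E. \<omega> e * (x e \<bullet> (\<pi> (s e) - \<pi> (t e)))) = 0"
  proof -
    have "(\<Sum>e\<in>E. \<omega> e * (x e \<bullet> (\<pi> (s e) - \<pi> (t e)))) = B \<bullet> z"
      by (simp add: B_def inner_sum_left \<pi>_def scaleR_diff_left[symmetric] mult.assoc)
    then show ?thesis using z by simp
  qed
  have "finite (E - {e0})" using fin by simp
  \<comment> \<open>Solve all edge conditions but that of \<open>e0\<close>; its residual vanishes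
    because the residuals weighted by \<open>\<omega>\<close> sum to zero and
    \<open>\<omega> e0\<close> is nonzero.\<close>
  from rows_indep_surj[OF this finK indep[OF e0], of "\<lambda>e. - (x e \<bullet> (\<pi> (s e) - \<pi> (t e)))"]
  obtain g where g: "\<And>e. e \<in> E - {e0} \<Longrightarrow> (\<Sum>k\<in>K. u e k * g k) = - (x e \<bullet> (\<pi> (s e) - \<pi> (t e)))"
    by blast
  define h :: "'v \<Rightarrow> real^2" where "h = (\<lambda>v. if v \<in> I then \<chi> d. g (v, d) else 0)"
  have h_off: "h v = 0" if "v \<notin> I" for v using that by (simp add: h_def)
  have hg: "(\<Sum>k\<in>K. u e k * g k) = x e \<bullet> (h (s e) - h (t e))" for e
  proof -
    have "(\<Sum>k\<in>K. u e k * g k) = (\<Sum>k\<in>K. u e k * h (fst k) $ snd k)"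
      by (rule sum.cong) (auto simp: K_def h_def)
    then show ?thesis using u_prod[of h e, OF h_off] by simp
  qed
  define \<epsilon> where "\<epsilon> = (\<lambda>e. x e \<bullet> (h (s e) - h (t e)) + x e \<bullet> (\<pi> (s e) - \<pi> (t e)))"
  have \<epsilon>0: "\<epsilon> e = 0" if "e \<in> E" for e
  proof (cases "e = e0")
    case False
    then show ?thesis using g[of e] hg[of e] that by (simp add: \<epsilon>_def)
  next
    case True
    have "(\<Sum>e\<in>E. \<omega> e * (x e \<bullet> (h (s e) - h (t e)))) = (\<Sum>e\<in>E. \<Sum>k\<in>K. \<omega> e * u e k * g k)"
      by (simp add: hg[symmetric] sum_distrib_left mult.assoc)
    also have "\<dots> = (\<Sum>k\<in>K. (\<Sum>e\<in>E. \<omega> e * u e k) * g k)"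
      by (subst sum.swap) (simp add: sum_distrib_right)
    also have "\<dots> = 0" using \<omega> by simp
    finally have "(\<Sum>e\<in>E. \<omega> e * \<epsilon> e) = 0"
      using \<pi>_bal by (simp add: \<epsilon>_def distrib_left sum.distrib)
    moreover have "(\<Sum>e\<in>E - {e0}. \<omega> e * \<epsilon> e) = 0"
      by (rule sum.neutral) (use g hg in \<open>auto simp: \<epsilon>_def\<close>)
    ultimately have "\<omega> e0 * \<epsilon> e0 = 0" using e0 fin by (simp add: sum.remove[of E e0])
    then show ?thesis using \<omega>_nz[OF e0] True by simp
  qed

  \<comment> \<open>Adding a multiple of m keeps the edge directions and prevents collapsed edges.\<close>
  define pc where "pc = (\<lambda>(c::real) v. h v + \<pi> v + c *\<^sub>R m v)"
  have pc_diff: "pc c (s e) - pc c (t e) = (h (s e) - h (t e)) + (\<pi> (s e) - \<pi> (t e)) + c *\<^sub>R rot (x e)"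
    for c e unfolding pc_def m_diff[symmetric] by (simp add: algebra_simps)
  have rot_x_nz: "rot (x e) \<noteq> 0" if "e \<in> E" for e
  proof
    assume "rot (x e) = 0"
    then have "rot (rot (x e)) = 0" by simp
    then show False using x_nz[OF that] by simp
  qed
  \<comment> \<open>Since \<open>rot (x e)\<close> is nonzero, at most one \<open>c\<close>
    collapses the edge \<open>e\<close>.\<close>
  have "finite {c. pc c (s e) - pc c (t e) = 0}" if e: "e \<in> E" for e
  proof -
    have "c = c'" if "pc c (s e) - pc c (t e) = 0" "pc c' (s e) - pc c' (t e) = 0" for c c'
    proof -
      have "c *\<^sub>R rot (x e) = c' *\<^sub>R rot (x e)"
        using that unfolding pc_diff by (metis add_left_cancel)
      then show ?thesis using rot_x_nz[OF e] by simp
    qed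
    then have "\<exists>c. {c. pc c (s e) - pc c (t e) = 0} \<subseteq> {c}" by blast
    then show ?thesis by (auto intro: finite_subset)
  qed
  then have "finite (\<Union>e\<in>E. {c. pc c (s e) - pc c (t e) = 0})" using fin by blast
  then obtain c where c: "c \<notin> (\<Union>e\<in>E. {c. pc c (s e) - pc c (t e) = 0})"
    using ex_new_if_finite infinite_UNIV_char_0 by blast
  define p where "p = pc c"
  have p_nz: "p (s e) - p (t e) \<noteq> 0" if "e \<in> E" for e using c that by (auto simp: p_def)
  have "\<exists>\<gamma>. p (s e) - p (t e) = \<gamma> *\<^sub>R rot (x e)" if e: "e \<in> E" for e
  proof -
    have "(p (s e) - p (t e)) \<bullet> x e = \<epsilon> e"
      unfolding p_def pc_diff by (simp add: \<epsilon>_def inner_add_right inner_commute[of _ "x e"])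
    then have "(p (s e) - p (t e)) \<bullet> x e = 0" using \<epsilon>0[OF e] by simp
    then show ?thesis using orthogonal_imp_rot_multiple x_nz[OF e] by blast
  qed
  then obtain \<gamma> where \<gamma>: "\<And>e. e \<in> E \<Longrightarrow> p (s e) - p (t e) = \<gamma> e *\<^sub>R rot (x e)" by metis
  have \<gamma>_nz: "\<gamma> e \<noteq> 0" if "e \<in> E" for e using p_nz[OF that] \<gamma>[OF that] by auto

  \<comment> \<open>Pins, stresses and motions of the final placement\<close>
  have "inj_on p P"
  proof (rule inj_onI)
    fix v w assume vw: "v \<in> P" "w \<in> P" "p v = p w"
    then have "v \<notin> I" "w \<notin> I" using disj by auto
    then have "real (n v) *\<^sub>R z = real (n w) *\<^sub>R z"
      using vw by (simp add: p_def pc_def h_off m_off \<pi>_def \<alpha>_def)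
    then have "n v = n w" using z by simp
    then show "v = w" using n vw by (auto dest: inj_onD)
  qed
  moreover
  \<comment> \<open>A quarter turn swaps the two coordinate equations up to sign, so stresses of
    \<open>p\<close> are row dependencies reweighted by \<open>\<gamma>\<close>.\<close>
  have stress: "self_stress I E s t p \<mu> \<longleftrightarrow>
      (\<forall>e. e \<notin> E \<longrightarrow> \<mu> e = 0) \<and> (\<forall>k\<in>K. (\<Sum>e\<in>E. \<mu> e * \<gamma> e * u e k) = 0)" for \<mu>
  proof -
    let ?y = "\<lambda>i. \<Sum>e\<in>E. (\<mu> e * (of_bool (i = s e) - of_bool (i = t e))) *\<^sub>R (p (s e) - p (t e))"
    have "?y i $ 1 = - (\<Sum>e\<in>E. \<mu> e * \<gamma> e * u e (i, 2))" for i
      unfolding sum_component sum_negf[symmetric]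
      by (rule sum.cong) (simp_all add: \<gamma> u_def edge_row_def del: vector_minus_component)
    moreover have "?y i $ 2 = (\<Sum>e\<in>E. \<mu> e * \<gamma> e * u e (i, 1))" for i
      unfolding sum_component
      by (rule sum.cong) (simp_all add: \<gamma> u_def edge_row_def del: vector_minus_component)
    ultimately have "?y i = 0 \<longleftrightarrow> (\<forall>d. (\<Sum>e\<in>E. \<mu> e * \<gamma> e * u e (i, d)) = 0)" for i
      unfolding vec_eq_iff forall_2 by auto
    then show ?thesis unfolding self_stress_alt[OF fin(3)] K_def by auto
  qed
  define \<Lambda> where "\<Lambda> = (\<lambda>e. if e \<in> E then \<omega> e / \<gamma> e else 0)"
  have \<Lambda>\<gamma>: "(\<Sum>e\<in>E. \<Lambda> e * \<gamma> e * u e k) = (\<Sum>e\<in>E. \<omega> e * u e k)" for k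
    by (rule sum.cong) (use \<gamma>_nz in \<open>auto simp: \<Lambda>_def\<close>)
  have "self_stress I E s t p \<Lambda>" unfolding stress \<Lambda>\<gamma> using \<omega> by (auto simp: \<Lambda>_def)
  moreover have "\<forall>e\<in>E. \<Lambda> e \<noteq> 0" using \<omega>_nz \<gamma>_nz by (simp add: \<Lambda>_def)
  moreover have "\<exists>c. \<mu> = (\<lambda>e. c * \<Lambda> e)" if \<mu>: "self_stress I E s t p \<mu>" for \<mu>
  proof -
    obtain c where c: "\<And>e. e \<in> E \<Longrightarrow> \<mu> e * \<gamma> e = c * \<omega> e"
      using dep_line[of "\<lambda>e. \<mu> e * \<gamma> e"] \<mu> unfolding stress by blast
    have "\<mu> e = c * \<Lambda> e" for e
      using c[of e] \<gamma>_nz[of e] \<mu> unfolding stress by (auto simp: \<Lambda>_def field_simps)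
    then show ?thesis by blast
  qed
  \<comment> \<open>The edges were turned by a quarter, so the motion is the unturned field
    \<open>Q\<close>: its difference along \<open>e\<close> is \<open>x e\<close>, orthogonal to
    \<open>rot (x e)\<close>.\<close>
  moreover have "first_order_motion I E s t p Q"
    using Q_off inner_rot_self[of "x _"]
    by (simp add: first_order_motion_def \<gamma> inner_commute[of "rot _"]) (simp add: x_def)
  moreover have "\<exists>c. m' = (\<lambda>v. c *\<^sub>R Q v)" if "first_order_motion I E s t p m'" for m'
  proof -
    have m'_off: "m' v = 0" if "v \<notin> I" for v
      using that \<open>first_order_motion I E s t p m'\<close> by (simp add: first_order_motion_def)
    define y where "y = (\<lambda>v. rot (m' v))"
    have y_off: "y v = 0" if "v \<notin> I" for v using m'_off[OF that] by (simp add: y_def)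
    have "(\<Sum>k\<in>K. u e k * y (fst k) $ snd k) = 0" if e: "e \<in> E - {e0}" for e
    proof -
      have "(\<gamma> e *\<^sub>R rot (x e)) \<bullet> (m' (s e) - m' (t e)) = 0"
        using \<open>first_order_motion I E s t p m'\<close> \<gamma> e by (simp add: first_order_motion_def)
      then have "rot (x e) \<bullet> (m' (s e) - m' (t e)) = 0" using \<gamma>_nz e by simp
      then have "x e \<bullet> rot (m' (s e) - m' (t e)) = 0"
        using inner_rot_rot[of "rot (x e)" "m' (s e) - m' (t e)"] by simp
      then show ?thesis using u_prod[of y e, OF y_off] by (simp add: y_def rot_diff)
    qed
    \<comment> \<open>Omitting \<open>e0\<close> leaves one more column than rows, so the turned
      motion \<open>y\<close> lies on the kernel line spanned by \<open>m\<close>.\<close>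
    moreover have "card K \<le> Suc (card (E - {e0}))" using cardK e0 fin by simp
    ultimately obtain c where c: "\<And>k. k \<in> K \<Longrightarrow> y (fst k) $ snd k = c * m (fst k) $ snd k"
      using rows_indep_kernel_line[OF indep[OF e0] _ finK _ _ k0(1),
          of "\<lambda>k. m (fst k) $ snd k" "\<lambda>k. y (fst k) $ snd k"] m_ker k0(2) fin by auto
    have "m' v = c *\<^sub>R Q v" for v
    proof (cases "v \<in> I")
      case True
      then have "y v = c *\<^sub>R m v" using c[of "(v, _)"] by (auto simp: vec_eq_iff K_def)
      then have "rot (y v) = c *\<^sub>R rot (m v)" by (simp add: rot_scaleR)
      then show ?thesis by (simp add: y_def m_def)
    qed (simp add: m'_off Q_off)
    then show ?thesis by blast
  qed
  ultimately show ?thesis using Q_nz by blast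
qed

end
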